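(* Let $n>d\ge 1$ and $m\ge 1$ be integers, let $A\in\mathbb{R}^{n\times d}$, $b\in\mathbb{R}^n$, $S\in\mathbb{R}^{m\times n}$, and let $\lambda>0$, $\lambda_0>0$, $\tau>0$. Put $P_S=(A^TS^TSA+\lambda_0 I)^{-1}$. Let $(x_k)_{k\ge 0}$ be the iterative Hessian sketch iterates defined by $x_0=0$ and $$x_{k+1}=x_k-\tau P_S\bigl(A^T(Ax_k-b)+\lambda x_k\bigr),\qquad k\ge 0.$$ Then, for every $k\ge 1$, $x_k$ can be expressed as a polynomial function of $\lambda$ as $$x_k=\tau\sum_{j=0}^{k-1}(\tau\lambda)^j\,\tilde u_j,\qquad \tilde u_j=\sum_{i=j}^{k-1}u_{i,j},$$ where the vectors $u_{i,j}\in\mathbb{R}^d$ ($0\le j\le i$) are computed recursively by $u_{0,0}=P_SA^Tb$ and, for $i\ge 0$, $$u_{i+1,0}=(I-\tau P_SA^TA)u_{i,0},\qquad u_{i+1,i+1}=-P_Su_{i,i},$$ $$u_{i+1,j}=(I-\tau P_SA^TA)u_{i,j}-P_Su_{i,j-1},\qquad 1\le j\le i.$$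
   Context: The underlying problem is ridge regression $\min_{x\in\mathbb{R}^d}\frac12\|Ax-b\|_2^2+\frac{\lambda}{2}\|x\|_2^2$. The matrix $S\in\mathbb{R}^{m\times n}$ is a fixed (realized) sketching matrix, $\lambda_0$ is a fixed parameter not depending on $\lambda$, $\tau$ is the step size, and $I$ is the $d\times d$ identity matrix. *)

theory Defs
  imports "HOL-Analysis.Analysis"
begin

text \<open>
  The parameters written lam and lam0 are the regularisation parameter and the fixed
  parameter of the sketched Hessian. For lam0 > 0 the matrix below is positive definite,
  so \<open>matrix_inv\<close> is its genuine inverse.
\<close>

definition sketch_precond :: "real^'d^'n \<Rightarrow> real^'n^'m \<Rightarrow> real \<Rightarrow> real^'d^'d" where
  "sketch_precond A S lam0 =
     matrix_inv (transpose A ** transpose S ** S ** A + lam0 *\<^sub>R mat 1)"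

primrec ihs_iterate ::
  "real^'d^'n \<Rightarrow> real^'n \<Rightarrow> real^'n^'m \<Rightarrow> real \<Rightarrow> real \<Rightarrow> real \<Rightarrow> nat \<Rightarrow> real^'d" where
  "ihs_iterate A b S lam0 \<tau> lam 0 = 0"
| "ihs_iterate A b S lam0 \<tau> lam (Suc k) =
     (let x = ihs_iterate A b S lam0 \<tau> lam k in
      x - \<tau> *\<^sub>R (sketch_precond A S lam0 *v (transpose A *v (A *v x - b) + lam *\<^sub>R x)))"

text \<open>
  The vectors \<open>u\<^sub>i\<^sub>,\<^sub>j\<close>. They do not take lam as an argument. Only the triangle
  \<open>j \<le> i\<close> is meaningful; the value 0 for \<open>j > i\<close> is a dummy that is never used.
\<close>

primrec ihs_u ::
  "real^'d^'n \<Rightarrow> real^'n \<Rightarrow> real^'n^'m \<Rightarrow> real \<Rightarrow> real \<Rightarrow> nat \<Rightarrow> nat \<Rightarrow> real^'d" where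
  "ihs_u A b S lam0 \<tau> 0 j =
     (if j = 0 then sketch_precond A S lam0 *v (transpose A *v b) else 0)"
| "ihs_u A b S lam0 \<tau> (Suc i) j =
     (let P = sketch_precond A S lam0;
          M = mat 1 - \<tau> *\<^sub>R (P ** transpose A ** A);
          u = ihs_u A b S lam0 \<tau> i
      in if j = 0 then M *v u 0
         else if j = Suc i then - (P *v u i)
         else if j \<le> i then M *v u j - P *v u (j - 1)
         else 0)"

definition ihs_u_tilde ::
  "real^'d^'n \<Rightarrow> real^'n \<Rightarrow> real^'n^'m \<Rightarrow> real \<Rightarrow> real \<Rightarrow> nat \<Rightarrow> nat \<Rightarrow> real^'d" where
  "ihs_u_tilde A b S lam0 \<tau> k j = (\<Sum>i = j..k - 1. ihs_u A b S lam0 \<tau> i j)"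

end

theory Submission
  imports Defs
begin

text \<open>
  Write \<open>P\<close> for the sketched preconditioner, \<open>M = I - \<tau> P A\<^sup>T A\<close> and \<open>T = M - \<tau> \<lambda> P\<close>. The
  iteration is affine, \<open>x\<^bsub>k+1\<^esub> = T x\<^bsub>k\<^esub> + \<tau> P A\<^sup>T b\<close>, so starting from \<open>0\<close> it produces the geometric sum
  \<open>x\<^bsub>k\<^esub> = \<tau> \<Sum>\<^bsub>i<k\<^esub> T\<^sup>i P A\<^sup>T b\<close>. Expanding the noncommutative power \<open>T\<^sup>i\<close> in powers of the scalar
  \<open>\<tau> \<lambda>\<close>, the vector \<open>u\<^bsub>i,j\<^esub>\<close> is the coefficient of \<open>(\<tau> \<lambda>)\<^sup>j\<close> in \<open>T\<^sup>i P A\<^sup>T b\<close>: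
  the recursion for \<open>u\<close> only compares coefficients in \<open>T\<^bsup>i+1\<^esup> = (M - \<tau> \<lambda> P) T\<^sup>i\<close>
  (\<open>ihs_poly_Suc\<close>). Interchanging the two sums collects, for each power of \<open>\<tau> \<lambda>\<close>, the
  coefficients \<open>u\<^bsub>i,j\<^esub>\<close> with \<open>j \<le> i < k\<close>, which is the stated polynomial in \<open>\<lambda>\<close>.
\<close>

definition ihs_step_matrix ::
  "real^'d^'n \<Rightarrow> real^'n^'m \<Rightarrow> real \<Rightarrow> real \<Rightarrow> real^'d^'d" where
  "ihs_step_matrix A S lam0 \<tau> =
     mat 1 - \<tau> *\<^sub>R (sketch_precond A S lam0 ** transpose A ** A)"

text \<open>
  The polynomial in \<open>t\<close> whose value at \<open>t = \<tau> \<lambda>\<close> is \<open>T\<^sup>i P A\<^sup>T b\<close>.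
\<close>

definition ihs_poly ::
  "real^'d^'n \<Rightarrow> real^'n \<Rightarrow> real^'n^'m \<Rightarrow> real \<Rightarrow> real \<Rightarrow> real \<Rightarrow> nat \<Rightarrow> real^'d" where
  "ihs_poly A b S lam0 \<tau> t i = (\<Sum>j\<le>i. t ^ j *\<^sub>R ihs_u A b S lam0 \<tau> i j)"

lemma ihs_u_above_diagonal: "i < j \<Longrightarrow> ihs_u A b S lam0 \<tau> i j = 0"
  by (cases i) (auto simp: Let_def)

text \<open>
  Since \<open>u\<close> vanishes above the diagonal, the diagonal and interior cases of its recursion are
  instances of one formula.
\<close>

lemma ihs_u_Suc_Suc:
  "ihs_u A b S lam0 \<tau> (Suc i) (Suc j) =
     ihs_step_matrix A S lam0 \<tau> *v ihs_u A b S lam0 \<tau> i (Suc j)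
       - sketch_precond A S lam0 *v ihs_u A b S lam0 \<tau> i j"
  by (auto simp: Let_def ihs_step_matrix_def ihs_u_above_diagonal)

lemma ihs_u_Suc_0:
  "ihs_u A b S lam0 \<tau> (Suc i) 0 = ihs_step_matrix A S lam0 \<tau> *v ihs_u A b S lam0 \<tau> i 0"
  by (simp add: Let_def ihs_step_matrix_def)

lemma matrix_vector_mult_weighted_sum:
  fixes B :: "real^'d^'n" and c :: "'i \<Rightarrow> real"
  shows "B *v (\<Sum>i\<in>I. c i *\<^sub>R v i) = (\<Sum>i\<in>I. c i *\<^sub>R (B *v v i))"
  by (simp add: linear_sum[OF matrix_vector_mul_linear] linear_scale[OF matrix_vector_mul_linear])

lemma ihs_poly_extend:
  assumes "i < k"
  shows "ihs_poly A b S lam0 \<tau> t i = (\<Sum>j<k. t ^ j *\<^sub>R ihs_u A b S lam0 \<tau> i j)"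
  unfolding ihs_poly_def using assms
  by (intro sum.mono_neutral_left) (auto simp: ihs_u_above_diagonal)

text \<open>
  Multiplication by \<open>M - t P\<close> acts on the coefficients by \<open>M\<close> in the same degree and by
  \<open>-P\<close> with a degree shift, which is exactly how \<open>u\<close> passes from row \<open>i\<close> to row \<open>i + 1\<close>.
\<close>

lemma ihs_poly_Suc:
  "ihs_poly A b S lam0 \<tau> t (Suc i) =
     ihs_step_matrix A S lam0 \<tau> *v ihs_poly A b S lam0 \<tau> t i
       - t *\<^sub>R (sketch_precond A S lam0 *v ihs_poly A b S lam0 \<tau> t i)"
proof -
  let ?u = "ihs_u A b S lam0 \<tau>" and ?M = "ihs_step_matrix A S lam0 \<tau>"
    and ?P = "sketch_precond A S lam0"
  \<comment> \<open>The row is padded by its zero entry in degree \<open>i + 1\<close>, so that the degree-preserving part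
    of the new row has the same index range.\<close>
  have M: "?M *v ihs_poly A b S lam0 \<tau> t i =
      ?M *v ?u i 0 + (\<Sum>j\<le>i. t ^ Suc j *\<^sub>R (?M *v ?u i (Suc j)))"
  proof -
    have "ihs_poly A b S lam0 \<tau> t i = (\<Sum>j<Suc (Suc i). t ^ j *\<^sub>R ?u i j)"
      by (rule ihs_poly_extend) simp
    also have "\<dots> = ?u i 0 + (\<Sum>j\<le>i. t ^ Suc j *\<^sub>R ?u i (Suc j))"
      by (simp only: lessThan_Suc_atMost sum.atMost_Suc_shift power_0 scaleR_one)
    finally show ?thesis
      by (simp only: matrix_vector_right_distrib matrix_vector_mult_weighted_sum)
  qed
  have P: "t *\<^sub>R (?P *v ihs_poly A b S lam0 \<tau> t i) = (\<Sum>j\<le>i. t ^ Suc j *\<^sub>R (?P *v ?u i j))"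
    by (simp add: ihs_poly_def matrix_vector_mult_weighted_sum scaleR_sum_right)
  have "ihs_poly A b S lam0 \<tau> t (Suc i) =
      ?u (Suc i) 0 + (\<Sum>j\<le>i. t ^ Suc j *\<^sub>R ?u (Suc i) (Suc j))"
    by (simp add: ihs_poly_def sum.atMost_Suc_shift del: sum.atMost_Suc power_Suc ihs_u.simps)
  also have "\<dots> = ?M *v ?u i 0 + (\<Sum>j\<le>i. t ^ Suc j *\<^sub>R (?M *v ?u i (Suc j)))
      - (\<Sum>j\<le>i. t ^ Suc j *\<^sub>R (?P *v ?u i j))"
    by (simp only: ihs_u_Suc_0 ihs_u_Suc_Suc scaleR_right_diff_distrib sum_subtractf
        add_diff_eq)
  finally show ?thesis
    by (simp only: M P)
qed

lemma ihs_iterate_affine: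
  "ihs_iterate A b S lam0 \<tau> lam (Suc k) =
     ihs_step_matrix A S lam0 \<tau> *v ihs_iterate A b S lam0 \<tau> lam k
       - (\<tau> * lam) *\<^sub>R (sketch_precond A S lam0 *v ihs_iterate A b S lam0 \<tau> lam k)
       + \<tau> *\<^sub>R ihs_u A b S lam0 \<tau> 0 0"
  by (simp add: Let_def ihs_step_matrix_def matrix_vector_mult_diff_rdistrib
      matrix_vector_mult_diff_distrib matrix_vector_right_distrib
      matrix_vector_mult_scaleR scaleR_matrix_vector_assoc[symmetric]
      matrix_vector_mul_assoc[symmetric] algebra_simps)

lemma ihs_iterate_eq_sum_ihs_poly:
  "ihs_iterate A b S lam0 \<tau> lam k = \<tau> *\<^sub>R (\<Sum>i<k. ihs_poly A b S lam0 \<tau> (\<tau> * lam) i)"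
proof (induction k)
  case 0
  then show ?case by simp
next
  case (Suc k)
  let ?p = "ihs_poly A b S lam0 \<tau> (\<tau> * lam)" and ?M = "ihs_step_matrix A S lam0 \<tau>"
    and ?P = "sketch_precond A S lam0"
  have p0: "?p 0 = ihs_u A b S lam0 \<tau> 0 0"
    by (simp add: ihs_poly_def)
  \<comment> \<open>Applying \<open>T\<close> to the geometric sum shifts it, and the affine term restores the summand
    of index \<open>0\<close>.\<close>
  have shift: "(\<Sum>i<k. ?p (Suc i)) =
      ?M *v (\<Sum>i<k. ?p i) - (\<tau> * lam) *\<^sub>R (?P *v (\<Sum>i<k. ?p i))"
    by (simp add: ihs_poly_Suc sum_subtractf linear_sum[OF matrix_vector_mul_linear]
        scaleR_sum_right)
  have "ihs_iterate A b S lam0 \<tau> lam (Suc k) = \<tau> *\<^sub>R ((\<Sum>i<k. ?p (Suc i)) + ?p 0)"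
    unfolding ihs_iterate_affine Suc.IH shift p0
    by (simp only: matrix_vector_mult_scaleR scaleR_right_distrib scaleR_right_diff_distrib
        scaleR_left_commute)
  then show ?case
    by (simp only: sum.lessThan_Suc_shift add.commute)
qed

theorem proposition1:
  fixes A :: "real^'d^'n"
    and b :: "real^'n"
    and S :: "real^'n^'m"
    and lam0 \<tau> lam :: real
    and k :: nat
  assumes "CARD('n) > CARD('d)"
    and "lam0 > 0" and "\<tau> > 0" and "lam > 0"
    and "k \<ge> 1"
  shows "ihs_iterate A b S lam0 \<tau> lam k =
    \<tau> *\<^sub>R (\<Sum>j = 0..k - 1. (\<tau> * lam) ^ j *\<^sub>R ihs_u_tilde A b S lam0 \<tau> k j)"
proof -
  let ?u = "ihs_u A b S lam0 \<tau>" and ?t = "\<tau> * lam"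
  have range: "{0..k - 1} = {..<k}"
    using assms(5) by auto
  have column: "(\<Sum>i<k. ?u i j) = ihs_u_tilde A b S lam0 \<tau> k j" for j
    unfolding ihs_u_tilde_def using assms(5)
    by (intro sum.mono_neutral_right) (auto simp: ihs_u_above_diagonal)
  have "(\<Sum>i<k. ihs_poly A b S lam0 \<tau> ?t i) = (\<Sum>i<k. \<Sum>j<k. ?t ^ j *\<^sub>R ?u i j)"
    by (intro sum.cong) (auto simp: ihs_poly_extend)
  also have "\<dots> = (\<Sum>j<k. ?t ^ j *\<^sub>R (\<Sum>i<k. ?u i j))"
    by (subst sum.swap) (simp only: scaleR_sum_right)
  finally show ?thesis
    unfolding ihs_iterate_eq_sum_ihs_poly range column by simp
qed

end
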